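(* Let $G_1$ be the graph on vertices $u_1,\dots,u_{11}$ consisting of the $5$-cycle $u_1u_2u_3u_4u_5u_1$ together with the edges $u_2u_6, u_3u_7, u_6u_7, u_6u_8, u_7u_8$ and the edges $u_5u_9, u_4u_{10}, u_9u_{10}, u_9u_{11}, u_{10}u_{11}$. Then $G_1$ is subcubic, outerplanar, and $2$-connected, and $G_1$ has no $(1^2,2^2)$-packing edge-coloring.
   Context: A graph is subcubic if its maximum degree is at most $3$. The distance between two distinct edges of a graph is their distance in its line graph, so edges sharing an endpoint are at distance $1$. For a non-decreasing sequence $S=(s_1,\dots,s_k)$ of positive integers, an $S$-packing edge-coloring of a graph $H$ is a partition of $E(H)$ into (possibly empty) classes $E_1,\dots,E_k$ such that, for each $i$, any two distinct edges in $E_i$ are at distance at least $s_i+1$. Exponents denote repetition: $(1^2,2^2)=(1,1,2,2)$. *)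

theory Defs
  imports "HOL-Analysis.Analysis"
begin

record 'a graph =
  verts :: "'a set"
  edges :: "'a set set"

definition simple_graph :: "'a graph \<Rightarrow> bool" where
  "simple_graph G \<longleftrightarrow>
     finite (verts G) \<and> (\<forall>e\<in>edges G. e \<subseteq> verts G \<and> card e = 2)"

text \<open>The notions below are meant for graphs satisfying \<open>simple_graph\<close>; for instance
  \<open>vdegree\<close> is a junk value at a vertex with infinitely many incident edges.\<close>

definition vdegree :: "'a graph \<Rightarrow> 'a \<Rightarrow> nat" where
  "vdegree G v = card {e \<in> edges G. v \<in> e}"

definition subcubic :: "'a graph \<Rightarrow> bool" where
  "subcubic G \<longleftrightarrow> (\<forall>v\<in>verts G. vdegree G v \<le> 3)"

definition adj :: "'a graph \<Rightarrow> ('a \<times> 'a) set" where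
  "adj G = {(u, v). {u, v} \<in> edges G}"

definition connected_graph :: "'a graph \<Rightarrow> bool" where
  "connected_graph G \<longleftrightarrow>
     verts G \<noteq> {} \<and> (\<forall>u\<in>verts G. \<forall>v\<in>verts G. (u, v) \<in> (adj G)\<^sup>*)"

definition delete_verts :: "'a graph \<Rightarrow> 'a set \<Rightarrow> 'a graph" where
  "delete_verts G X = \<lparr>verts = verts G - X, edges = {e \<in> edges G. e \<inter> X = {}}\<rparr>"

definition k_connected :: "nat \<Rightarrow> 'a graph \<Rightarrow> bool" where
  "k_connected k G \<longleftrightarrow>
     card (verts G) > k \<and>
     (\<forall>X. X \<subseteq> verts G \<and> card X < k \<longrightarrow> connected_graph (delete_verts G X))"

text \<open>Least length of a walk from \<open>u\<close> to \<open>v\<close>; the infimum of the empty set is \<open>\<infinity>\<close>,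
  which is the distance between vertices in different components.\<close>

definition graph_dist :: "'a graph \<Rightarrow> 'a \<Rightarrow> 'a \<Rightarrow> enat" where
  "graph_dist G u v = (INF n\<in>{n. (u, v) \<in> adj G ^^ n}. enat n)"

definition line_graph :: "'a graph \<Rightarrow> 'a set graph" where
  "line_graph G =
     \<lparr>verts = edges G,
      edges = {{e, f} | e f. e \<in> edges G \<and> f \<in> edges G \<and> e \<noteq> f \<and> e \<inter> f \<noteq> {}}\<rparr>"

definition edge_dist :: "'a graph \<Rightarrow> 'a set \<Rightarrow> 'a set \<Rightarrow> enat" where
  "edge_dist G = graph_dist (line_graph G)"

text \<open>\<open>S\<close> is meant to be a non-decreasing list of positive integers, indexed from \<open>0\<close>;
  \<open>C i\<close> is the (possibly empty) class with parameter \<open>S ! i\<close>.\<close>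

definition packing_edge_coloring :: "nat list \<Rightarrow> 'a graph \<Rightarrow> (nat \<Rightarrow> 'a set set) \<Rightarrow> bool" where
  "packing_edge_coloring S H C \<longleftrightarrow>
     (\<Union>i<length S. C i) = edges H \<and>
     disjoint_family_on C {..<length S} \<and>
     (\<forall>i<length S. \<forall>e\<in>C i. \<forall>f\<in>C i. e \<noteq> f \<longrightarrow> edge_dist H e f \<ge> enat (S ! i + 1))"

text \<open>A drawing in the plane without crossings: \<open>p\<close> places the vertices and \<open>\<gamma> e\<close> is a simple
  arc joining the two ends of the edge \<open>e\<close>.\<close>

definition plane_drawing ::
    "'a graph \<Rightarrow> ('a \<Rightarrow> complex) \<Rightarrow> ('a set \<Rightarrow> real \<Rightarrow> complex) \<Rightarrow> bool" where
  "plane_drawing G p \<gamma> \<longleftrightarrow>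
     inj_on p (verts G) \<and>
     (\<forall>e\<in>edges G. arc (\<gamma> e) \<and> {pathstart (\<gamma> e), pathfinish (\<gamma> e)} = p ` e \<and>
        path_image (\<gamma> e) \<inter> p ` verts G = p ` e) \<and>
     (\<forall>e\<in>edges G. \<forall>f\<in>edges G. e \<noteq> f \<longrightarrow>
        path_image (\<gamma> e) \<inter> path_image (\<gamma> f) \<subseteq> p ` (e \<inter> f))"

definition drawing_image ::
    "'a graph \<Rightarrow> ('a \<Rightarrow> complex) \<Rightarrow> ('a set \<Rightarrow> real \<Rightarrow> complex) \<Rightarrow> complex set" where
  "drawing_image G p \<gamma> = p ` verts G \<union> (\<Union>e\<in>edges G. path_image (\<gamma> e))"

text \<open>The drawing of a finite graph is compact, so \<open>outside\<close> (the union of the unbounded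
  components of the complement) is its outer face.\<close>

definition outerplanar :: "'a graph \<Rightarrow> bool" where
  "outerplanar G \<longleftrightarrow>
     (\<exists>p \<gamma>. plane_drawing G p \<gamma> \<and> p ` verts G \<subseteq> frontier (outside (drawing_image G p \<gamma>)))"

text \<open>The vertex \<open>u\<^sub>i\<close> is the number \<open>i\<close>.\<close>

definition G1 :: "nat graph" where
  "G1 = \<lparr>verts = {1..11},
         edges = {{1, 2}, {2, 3}, {3, 4}, {4, 5}, {5, 1},
                  {2, 6}, {3, 7}, {6, 7}, {6, 8}, {7, 8},
                  {5, 9}, {4, 10}, {9, 10}, {9, 11}, {10, 11}}\<rparr>"

lemma simple_graph_G1: "simple_graph G1"
  by (simp add: simple_graph_def G1_def)

end

(* A Hamiltonian cycle u1 u2 u6 u8 u7 u3 u4 u10 u11 u9 u5 gives 2-connectedness. Placed on a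
   parabola in the order of this cycle, the vertices see no two edges cross as chords, and every
   vertex is an extreme point of the epigraph, which contains the drawing.

   For the colouring, call colours 0 and 1 the matchings and 2 and 3 the induced matchings. Two of
   the six edges spanned by u2, u3, u6, u7, u8 are always within distance 2, so each of the colours
   2 and 3 occurs at most once among them, which leaves so little room that u1u2 and u3u4 receive
   different colours of the same kind. By symmetry so do u1u5 and u3u4. Then u1u2, u3u4 and u1u5
   are three differently coloured edges of one kind, but there are only two colours of each kind. *)

theory Submission imports Defs begin

section \<open>Outerplanarity\<close>

definition parabola :: "real \<Rightarrow> complex" where
  "parabola x = Complex x (x\<^sup>2)"

lemma parabola_simps [simp]: "Re (parabola x) = x" "Im (parabola x) = x\<^sup>2"
  by (simp_all add: parabola_def)

lemma parabola_eq_iff [simp]: "parabola x = parabola y \<longleftrightarrow> x = y"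
  by (metis parabola_simps(1))

text \<open>The chord is the graph of (a + b) x - a b, and subtracting x^2 leaves the factored
  height above the parabola, which vanishes only at the two ends.\<close>

lemma parabola_chord:
  assumes "z \<in> closed_segment (parabola a) (parabola b)" "a < b"
  shows "a \<le> Re z" "Re z \<le> b" "Im z - (Re z)\<^sup>2 = (Re z - a) * (b - Re z)"
proof -
  obtain u where u: "0 \<le> u" "u \<le> 1" and z: "z = (1 - u) *\<^sub>R parabola a + u *\<^sub>R parabola b"
    using assms(1) by (auto simp: in_segment)
  have re: "Re z = a + u * (b - a)"
    by (simp add: z algebra_simps)
  have "0 \<le> u * (b - a)" "u * (b - a) \<le> 1 * (b - a)"
    using u assms(2) by (simp, intro mult_right_mono) auto
  then show "a \<le> Re z" "Re z \<le> b"
    by (simp_all add: re)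
  have im: "Im z = (1 - u) * a\<^sup>2 + u * b\<^sup>2"
    by (simp add: z)
  show "Im z - (Re z)\<^sup>2 = (Re z - a) * (b - Re z)"
    unfolding re im by (simp add: algebra_simps power2_eq_square)
qed

text \<open>At a fixed abscissa the height (x - a) (b - x) grows strictly when the interval is
  enlarged, so chords over nested intervals can meet only at height 0, that is, in a common
  end.\<close>

lemma noncrossing_chords_inter:
  assumes z: "z \<in> closed_segment (parabola a) (parabola b)" "z \<in> closed_segment (parabola c) (parabola d)"
    and less: "a < b" "c < d"
    and noncross: "\<not> (a < c \<and> c < b \<and> b < d)" "\<not> (c < a \<and> a < d \<and> d < b)"
    and neq: "(a, b) \<noteq> (c, d)"
  shows "\<exists>x. x \<in> {a, b} \<and> x \<in> {c, d} \<and> z = parabola x"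
proof -
  define x h where "x = Re z" and "h = Im z - (Re z)\<^sup>2"
  have ab: "a \<le> x" "x \<le> b" "h = (x - a) * (b - x)"
    using parabola_chord[OF z(1) less(1)] by (auto simp: x_def h_def)
  have cd: "c \<le> x" "x \<le> d" "h = (x - c) * (d - x)"
    using parabola_chord[OF z(2) less(2)] by (auto simp: x_def h_def)
  have "h = 0"
  proof (rule ccontr)
    assume "h \<noteq> 0"
    with ab cd have strict: "a < x" "x < b" "c < x" "x < d"
      by (auto simp: less_le)
    have strictly_above: "(x - c') * (d' - x) < (x - a') * (b' - x)"
      if "a' \<le> c'" "c' < x" "x < d'" "d' \<le> b'" "(a', b') \<noteq> (c', d')" for a' b' c' d'
    proof (cases "a' = c'")
      case True
      with that show ?thesis by (auto intro: mult_strict_left_mono)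
    next
      case False
      with that show ?thesis by (intro mult_less_le_imp_less) auto
    qed
    \<comment> \<open>Both open intervals contain \<open>x\<close>, so they are not disjoint;
      without a crossing they must be nested.\<close>
    have "a \<le> c \<and> d \<le> b \<or> c \<le> a \<and> b \<le> d"
      using strict noncross by linarith
    then show False
      using strictly_above[of a c d b] strictly_above[of c a b d] strict ab(3) cd(3) neq by auto
  qed
  then have "z = parabola x"
    by (simp add: complex_eq_iff x_def h_def)
  moreover have "x \<in> {a, b}" "x \<in> {c, d}"
    using \<open>h = 0\<close> ab(3) cd(3) by auto
  ultimately show ?thesis by blast
qed

text \<open>Vertices go to the parabola at abscissa \<open>f v\<close> and edges become chords. One
  interleaving pattern suffices in \<open>noncross\<close>, since the two edges and the ends of each
  may be exchanged.\<close>

theorem outerplanar_if_noncrossing: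
  fixes G :: "'a graph" and f :: "'a \<Rightarrow> real"
  assumes G: "simple_graph G" and inj: "inj_on f (verts G)"
    and noncross: "\<And>a b c d. {a, b} \<in> edges G \<Longrightarrow> {c, d} \<in> edges G \<Longrightarrow>
      \<not> (f a < f c \<and> f c < f b \<and> f b < f d)"
  shows "outerplanar G"
proof -
  have "\<exists>a b. e = {a, b} \<and> a \<in> verts G \<and> b \<in> verts G \<and> f a < f b" if "e \<in> edges G" for e
  proof -
    have "e \<subseteq> verts G" "card e = 2"
      using G that by (auto simp: simple_graph_def)
    then obtain a b where ab: "e = {a, b}" "a \<noteq> b" "a \<in> verts G" "b \<in> verts G"
      by (auto simp: card_2_iff)
    then have "f a \<noteq> f b"
      using inj by (auto simp: inj_on_def)
    with ab show ?thesis
      by (metis insert_commute linorder_neqE_linordered_idom)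
  qed
  \<comment> \<open>Each edge is directed from its left end \<open>s e\<close> to its right end
    \<open>t e\<close>.\<close>
  then obtain s t where
    st: "\<And>e. e \<in> edges G \<Longrightarrow> e = {s e, t e}" "\<And>e. e \<in> edges G \<Longrightarrow> f (s e) < f (t e)"
      "\<And>e. e \<in> edges G \<Longrightarrow> s e \<in> verts G" "\<And>e. e \<in> edges G \<Longrightarrow> t e \<in> verts G"
    by metis
  define p where "p v = parabola (f v)" for v
  define \<gamma> where "\<gamma> e = linepath (p (s e)) (p (t e))" for e
  have inj_p: "inj_on p (verts G)"
    using inj by (auto simp: inj_on_def p_def)
  have "plane_drawing G p \<gamma>"
    unfolding plane_drawing_def
  proof (intro conjI ballI impI)
    fix e assume e: "e \<in> edges G"
    show "arc (\<gamma> e)"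
      using st(2)[OF e] by (simp add: \<gamma>_def p_def)
    have pe: "p ` e = {p (s e), p (t e)}"
      by (subst st(1)[OF e]) simp
    then show "{pathstart (\<gamma> e), pathfinish (\<gamma> e)} = p ` e"
      by (simp add: \<gamma>_def)
    \<comment> \<open>A vertex has height 0 above the parabola, so on a chord it can only be an
      end.\<close>
    have "p v \<in> p ` e" if v: "p v \<in> path_image (\<gamma> e)" for v
    proof -
      have "(f v - f (s e)) * (f (t e) - f v) = 0"
        using parabola_chord(3)[of "p v" "f (s e)" "f (t e)"] v st(2)[OF e]
        by (simp add: \<gamma>_def p_def)
      then have "p v \<in> {p (s e), p (t e)}"
        by (auto simp: p_def)
      then show ?thesis
        by (simp only: pe)
    qed
    moreover have "p ` e \<subseteq> path_image (\<gamma> e)"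
      by (simp add: pe \<gamma>_def)
    moreover have "p ` e \<subseteq> p ` verts G"
      using st(3,4)[OF e] by (simp add: pe)
    ultimately show "path_image (\<gamma> e) \<inter> p ` verts G = p ` e"
      by blast
  next
    fix e e' assume e: "e \<in> edges G" and e': "e' \<in> edges G" and neq: "e \<noteq> e'"
    show "path_image (\<gamma> e) \<inter> path_image (\<gamma> e') \<subseteq> p ` (e \<inter> e')"
    proof
      fix z assume z: "z \<in> path_image (\<gamma> e) \<inter> path_image (\<gamma> e')"
      have "(f (s e), f (t e)) \<noteq> (f (s e'), f (t e'))"
        using neq st(1)[OF e] st(1)[OF e'] inj st(3,4)[OF e] st(3,4)[OF e']
        by (metis inj_onD prod.inject)
      then have "\<exists>x. x \<in> {f (s e), f (t e)} \<and> x \<in> {f (s e'), f (t e')} \<and> z = parabola x"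
        using z st e e' noncross[of "s e" "t e" "s e'" "t e'"] noncross[of "s e'" "t e'" "s e" "t e"]
        by (intro noncrossing_chords_inter) (auto simp: \<gamma>_def p_def)
      then obtain x where "x \<in> f ` {s e, t e}" "x \<in> f ` {s e', t e'}" "z = parabola x"
        by auto
      then obtain v w where vw: "v \<in> {s e, t e}" "w \<in> {s e', t e'}" "f v = f w" "z = p v"
        unfolding p_def by (elim imageE) blast
      then have "v = w"
        using inj st(3,4)[OF e] st(3,4)[OF e'] by (auto simp: inj_on_def)
      then have "v \<in> e \<inter> e'"
        using vw st(1)[OF e] st(1)[OF e'] by blast
      with vw(4) show "z \<in> p ` (e \<inter> e')"
        by blast
    qed
  qed (fact inj_p)
  moreover have "p ` verts G \<subseteq> frontier (outside (drawing_image G p \<gamma>))"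
  proof (intro subsetI, elim imageE)
    fix z v assume z: "z = p v" and v: "v \<in> verts G"
    let ?D = "drawing_image G p \<gamma>"
    \<comment> \<open>The convex region on and above the parabola contains the drawing, so
      everything below the parabola belongs to the outer face.\<close>
    let ?E = "{w. (Re w)\<^sup>2 \<le> Im w}"
    have "convex (epigraph UNIV (\<lambda>x::real. x\<^sup>2))"
      by (intro convex_epigraphI convex_power2)
    then have "convex ((\<lambda>w. (Re w, Im w)) -` epigraph UNIV (\<lambda>x::real. x\<^sup>2))"
      by (intro convex_linear_vimage) (auto intro!: linearI)
    then have "convex ?E"
      by (simp add: epigraph_def vimage_def)
    moreover have "?D \<subseteq> ?E"
    proof -
      have "w \<in> ?E" if "e \<in> edges G" "w \<in> path_image (\<gamma> e)" for e w
      proof -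
        have "0 \<le> (Re w - f (s e)) * (f (t e) - Re w)"
          using parabola_chord[of w "f (s e)" "f (t e)"] st(2) that
          by (simp add: \<gamma>_def p_def)
        then show ?thesis
          using parabola_chord(3)[of w "f (s e)" "f (t e)"] st(2) that
          by (simp add: \<gamma>_def p_def)
      qed
      then show ?thesis
        by (auto simp: drawing_image_def p_def)
    qed
    ultimately have out: "- ?E \<subseteq> outside ?D"
      by (rule outside_subset_convex)
    have "z \<in> closure (outside ?D)"
      unfolding closure_approachable
    proof (intro allI impI)
      fix \<epsilon> :: real assume "0 < \<epsilon>"
      \<comment> \<open>Any step straight down from a vertex leaves \<open>?E\<close>; half of
        \<epsilon> keeps it within the required distance.\<close>
      then have "z - Complex 0 (\<epsilon> / 2) \<in> outside ?D" "dist (z - Complex 0 (\<epsilon> / 2)) z < \<epsilon>"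
        using out by (auto simp: z p_def dist_norm norm_complex_def)
      then show "\<exists>y\<in>outside ?D. dist y z < \<epsilon>" ..
    qed
    moreover have "z \<in> ?D"
      using v by (simp add: z drawing_image_def)
    then have "z \<notin> interior (outside ?D)"
      using interior_subset outside_no_overlap by blast
    ultimately show "z \<in> frontier (outside ?D)"
      by (simp add: frontier_def)
  qed
  ultimately show ?thesis
    unfolding outerplanar_def by blast
qed

section \<open>The non-crossing order of the vertices of \<open>G1\<close>\<close>

text \<open>The position along the Hamiltonian cycle; the vertices are not numbered in this order.\<close>

definition cycle_pos :: "nat \<Rightarrow> real" where
  "cycle_pos = (\<lambda>_. 0)(1 := 1, 2 := 2, 6 := 3, 8 := 4, 7 := 5, 3 := 6, 4 := 7, 10 := 8, 11 := 9, 9 := 10, 5 := 11)"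

lemma verts_G1: "verts G1 = {1, 2, 3, 4, 5, 6, 7, 8, 9, 10, 11}"
  by (simp add: G1_def atLeastAtMost_upt upt_rec eval_nat_numeral del: set_upt)

lemma outerplanar_G1: "outerplanar G1"
proof (rule outerplanar_if_noncrossing[of _ cycle_pos])
  show "inj_on cycle_pos (verts G1)"
    by (simp add: verts_G1 cycle_pos_def)
  \<comment> \<open>The fifteen edges as pairs of positions, smaller first; non-crossing becomes a
    finite check on this list.\<close>
  have chord: "(cycle_pos a, cycle_pos b) \<in> {(1, 2), (2, 6), (6, 7), (7, 11), (1, 11),
      (2, 3), (5, 6), (3, 5), (3, 4), (4, 5), (10, 11), (7, 8), (8, 10), (9, 10), (8, 9)}"
    if "{a, b} \<in> edges G1" "cycle_pos a < cycle_pos b" for a b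
    using that by (auto simp: G1_def cycle_pos_def doubleton_eq_iff)
  fix a b c d assume edges: "{a, b} \<in> edges G1" "{c, d} \<in> edges G1"
  show "\<not> (cycle_pos a < cycle_pos c \<and> cycle_pos c < cycle_pos b \<and> cycle_pos b < cycle_pos d)"
  proof
    assume "cycle_pos a < cycle_pos c \<and> cycle_pos c < cycle_pos b \<and> cycle_pos b < cycle_pos d"
    then show False
      using chord[OF edges(1)] chord[OF edges(2)] by auto
  qed
qed (fact simple_graph_G1)

section \<open>Connectivity\<close>

lemma successively_rtrancl_adj:
  assumes "successively (\<lambda>u v. {u, v} \<in> edges G) (u # us)" "v \<in> set (u # us)"
  shows "(u, v) \<in> (adj G)\<^sup>*"
  using assms
proof (induction us arbitrary: u)
  case (Cons w us)
  then have "(u, w) \<in> adj G"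
    by (simp add: adj_def)
  then show ?case
    using Cons by (auto intro: converse_rtrancl_into_rtrancl)
qed simp

lemma sym_adj: "sym (adj G)"
  by (auto simp: sym_def adj_def insert_commute)

lemma connected_graph_if_hamiltonian_path:
  assumes "verts G = set us" "us \<noteq> []" "successively (\<lambda>u v. {u, v} \<in> edges G) us"
  shows "connected_graph G"
proof -
  obtain w ws where us: "us = w # ws"
    using assms(2) by (cases us) auto
  have reach: "(w, v) \<in> (adj G)\<^sup>*" if "v \<in> verts G" for v
    using that assms successively_rtrancl_adj[of G w ws v] by (simp add: us)
  have "(u, v) \<in> (adj G)\<^sup>*" if "u \<in> verts G" "v \<in> verts G" for u v
    using reach[OF that(1)] reach[OF that(2)] sym_rtrancl[OF sym_adj]
    by (meson rtrancl_trans symD)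
  then show ?thesis
    using assms by (simp add: connected_graph_def)
qed

text \<open>Removing a vertex from a Hamiltonian cycle leaves a Hamiltonian path on the remaining
  vertices.\<close>

lemma two_connected_if_hamiltonian_cycle:
  assumes us: "verts G = set us" "distinct us" "length us > 2"
    and cycle: "successively (\<lambda>u v. {u, v} \<in> edges G) us" "{last us, hd us} \<in> edges G"
  shows "k_connected 2 G"
  unfolding k_connected_def
proof (intro conjI allI impI)
  show "2 < card (verts G)"
    using us by (simp add: distinct_card)
  fix X assume "X \<subseteq> verts G \<and> card X < 2"
  then have "X \<subseteq> set us" "finite X" "card X = 0 \<or> card X = 1"
    using us(1) by (auto intro: finite_subset)
  then consider "X = {}" | x where "X = {x}" "x \<in> set us"
    by (auto simp: card_1_singleton_iff)
  then show "connected_graph (delete_verts G X)"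
  proof cases
    case 1
    then show ?thesis
      using us cycle by (intro connected_graph_if_hamiltonian_path) (auto simp: delete_verts_def)
  next
    case 2
    then obtain xs ys where split: "us = xs @ x # ys"
      by (meson split_list)
    \<comment> \<open>The cycle is read from just after \<open>x\<close> round to just before it;
      the closing edge joins the end of \<open>ys\<close> to the start of \<open>xs\<close>.\<close>
    have "successively (\<lambda>u v. {u, v} \<in> edges G) (ys @ xs)"
      using cycle by (auto simp: split successively_append_iff successively_Cons hd_append last_append split: if_splits)
    then have "successively (\<lambda>u v. {u, v} \<in> edges (delete_verts G X)) (ys @ xs)"
      by (rule successively_mono) (use us(2) in \<open>auto simp: delete_verts_def 2 split\<close>)
    then show ?thesis
      using us by (intro connected_graph_if_hamiltonian_path[of _ "ys @ xs"])
        (auto simp: delete_verts_def 2 split)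
  qed
qed

lemma two_connected_G1: "k_connected 2 G1"
  by (rule two_connected_if_hamiltonian_cycle[of _ "[1, 2, 6, 8, 7, 3, 4, 10, 11, 9, 5]"])
    (auto simp: verts_G1, simp_all add: G1_def doubleton_eq_iff)

section \<open>Maximum degree\<close>

lemma subcubic_G1: "subcubic G1"
proof -
  have filter_insert: "{e \<in> insert a A. P e} = (if P a then {a} else {}) \<union> {e \<in> A. P e}"
    for a :: "nat set" and A P
    by auto
  have "vdegree G1 v \<le> 3" if "v \<in> verts G1" for v
    using that unfolding verts_G1 vdegree_def
    by (elim insertE emptyE; simp only: G1_def graph.simps filter_insert)
      (simp_all add: card_insert_if doubleton_eq_iff)
  then show ?thesis by (simp add: subcubic_def)
qed

section \<open>Packing colourings\<close>

lemma edge_dist_le_1: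
  assumes "e \<in> edges G" "f \<in> edges G" "e \<noteq> f" "e \<inter> f \<noteq> {}"
  shows "edge_dist G e f \<le> 1"
proof -
  have "(e, f) \<in> adj (line_graph G) ^^ 1"
    using assms by (auto simp: adj_def line_graph_def)
  then show ?thesis
    unfolding edge_dist_def graph_dist_def one_enat_def by (intro INF_lower) simp
qed

lemma edge_dist_le_2:
  assumes "e \<in> edges G" "f \<in> edges G" "g \<in> edges G" "e \<noteq> g" "g \<noteq> f" "e \<inter> g \<noteq> {}" "g \<inter> f \<noteq> {}"
  shows "edge_dist G e f \<le> 2"
proof -
  have "(e, g) \<in> adj (line_graph G)" "(g, f) \<in> adj (line_graph G)"
    using assms by (auto simp: adj_def line_graph_def)
  then have "(e, f) \<in> adj (line_graph G) ^^ 2"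
    by (auto simp: numeral_2_eq_2)
  then have "edge_dist G e f \<le> enat 2"
    unfolding edge_dist_def graph_dist_def by (intro INF_lower) simp
  then show ?thesis
    by (simp add: numeral_eq_enat)
qed

text \<open>Choosing for each edge a class that contains it turns the partition into a colour
  function \<open>c\<close>.\<close>

lemma packing_edge_coloringE:
  assumes "packing_edge_coloring S G C"
  obtains c where "\<And>e. e \<in> edges G \<Longrightarrow> c e < length S"
    "\<And>e f. e \<in> edges G \<Longrightarrow> f \<in> edges G \<Longrightarrow> e \<noteq> f \<Longrightarrow> c e = c f \<Longrightarrow> enat (S ! c e + 1) \<le> edge_dist G e f"
proof -
  have "\<forall>e\<in>edges G. \<exists>i<length S. e \<in> C i"
    using assms by (auto simp: packing_edge_coloring_def)
  then obtain c where c: "\<And>e. e \<in> edges G \<Longrightarrow> c e < length S \<and> e \<in> C (c e)"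
    by metis
  show ?thesis
  proof (rule that[of c])
    fix e f assume "e \<in> edges G" "f \<in> edges G" "e \<noteq> f" "c e = c f"
    then show "enat (S ! c e + 1) \<le> edge_dist G e f"
      using assms c unfolding packing_edge_coloring_def by metis
  qed (use c in blast)
qed

section \<open>Colours on one gadget\<close>

lemma four_colours:
  fixes p q r s t :: nat
  assumes "distinct [p, q, r, s]" "p < 4" "q < 4" "r < 4" "s < 4" "t < 4"
  shows "t = p \<or> t = q \<or> t = r \<or> t = s"
proof -
  have "card {p, q, r, s} = card {..<4::nat}" "{p, q, r, s} \<subseteq> {..<4}"
    using assms by auto
  then have "{p, q, r, s} = {..<4}"
    by (intro card_subset_eq) auto
  then show ?thesis
    using assms(6) by blast
qed

text \<open>In the next two lemmas \<open>x, a, y\<close> are the colours of \<open>u\<^sub>1u\<^sub>2, u\<^sub>2u\<^sub>3, u\<^sub>3u\<^sub>4\<close>,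
  and \<open>b, c, d, e, g\<close> those of \<open>u\<^sub>2u\<^sub>6, u\<^sub>3u\<^sub>7, u\<^sub>6u\<^sub>7, u\<^sub>6u\<^sub>8, u\<^sub>7u\<^sub>8\<close>.\<close>

lemma rung_colour_less_2:
  fixes y a b c d e g :: nat
  assumes less: "y < 4" "a < 4" "b < 4" "c < 4" "d < 4" "e < 4" "g < 4"
    and neq: "a \<noteq> b" "a \<noteq> c" "b \<noteq> d" "b \<noteq> e" "c \<noteq> d" "c \<noteq> g" "d \<noteq> e" "d \<noteq> g" "e \<noteq> g"
      "y \<noteq> a" "y \<noteq> c"
    and far: "a = d \<Longrightarrow> a < 2" "a = g \<Longrightarrow> a < 2" "b = c \<Longrightarrow> b < 2" "b = g \<Longrightarrow> b < 2"
      "c = e \<Longrightarrow> c < 2" "y = b \<Longrightarrow> y < 2" "y = d \<Longrightarrow> y < 2" "y = g \<Longrightarrow> y < 2"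
  shows "b < 2"
proof (rule ccontr)
  assume b: "\<not> b < 2"
  \<comment> \<open>The triangle uses three colours, and \<open>b\<close>, being at least 2, repeats
    none of them: its edge meets two sides and is within distance 2 of the third.\<close>
  have "distinct [b, d, e, g]"
    using b neq(3,4,7-9) far(4) by auto
  then have all: "t = b \<or> t = d \<or> t = e \<or> t = g" if "t < 4" for t
    using less(3,5,6,7) that by (rule four_colours)
  have "c = e"
    using all[OF less(4)] neq(5,6) far(3) b by auto
  then have "c < 2"
    by (rule far)
  have "a < 2"
    using all[OF less(2)] neq(1,2) far(1,2) \<open>c = e\<close> by auto
  moreover have "y < 2"
    using all[OF less(1)] neq(11) far(6-8) \<open>c = e\<close> by auto
  \<comment> \<open>The three edges at \<open>u3\<close> have pairwise distinct colours
    \<open>y\<close>, \<open>a\<close>, \<open>c\<close>, all below 2.\<close>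
  ultimately show False
    using \<open>c < 2\<close> neq(2,10,11) by linarith
qed

lemma gadget_end_colours:
  fixes x y a b c d e g :: nat
  assumes less: "x < 4" "y < 4" "a < 4" "b < 4" "c < 4" "d < 4" "e < 4" "g < 4"
    and neq: "a \<noteq> b" "a \<noteq> c" "b \<noteq> d" "b \<noteq> e" "c \<noteq> d" "c \<noteq> g" "d \<noteq> e" "d \<noteq> g" "e \<noteq> g"
      "x \<noteq> a" "x \<noteq> b" "y \<noteq> a" "y \<noteq> c"
    and far: "a = d \<Longrightarrow> a < 2" "a = e \<Longrightarrow> a < 2" "a = g \<Longrightarrow> a < 2"
      "b = c \<Longrightarrow> b < 2" "b = g \<Longrightarrow> b < 2" "c = e \<Longrightarrow> c < 2"
      "x = c \<Longrightarrow> x < 2" "x = d \<Longrightarrow> x < 2" "x = e \<Longrightarrow> x < 2" "x = y \<Longrightarrow> x < 2"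
      "y = b \<Longrightarrow> y < 2" "y = d \<Longrightarrow> y < 2" "y = g \<Longrightarrow> y < 2"
  shows "x \<noteq> y \<and> (x < 2 \<longleftrightarrow> y < 2)"
proof -
  have b: "b < 2"
    by (rule rung_colour_less_2[of y a b c d e g]) (rule less neq | erule far)+
  \<comment> \<open>Reflecting the gadget exchanges \<open>x\<close> with \<open>y\<close>,
    \<open>b\<close> with \<open>c\<close> and \<open>e\<close> with \<open>g\<close>, and fixes
    \<open>a\<close> and \<open>d\<close>.\<close>
  have c: "c < 2"
    by (rule rung_colour_less_2[of x a c b d g e]) (rule less neq neq[symmetric] | erule far | use far(4) in simp)+
  show ?thesis
  proof (cases "a < 2")
    case True
    \<comment> \<open>Colours 0 and 1 are used up by \<open>a\<close>, \<open>b\<close> at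
      \<open>u2\<close> and by \<open>a\<close>, \<open>c\<close> at \<open>u3\<close>.\<close>
    have "2 \<le> x" "2 \<le> y"
      using True b c neq(1,2,10-13) by linarith+
    then show ?thesis
      using far(10) by auto
  next
    case False
    have "distinct [a, d, e, g]"
      using False neq(7-9) far(1-3) by auto
    then have all: "t = a \<or> t = d \<or> t = e \<or> t = g" if "t < 4" for t
      using less(3,6,7,8) that by (rule four_colours)
    have "b = g" "c = e"
      using all[OF less(4)] all[OF less(5)] neq(1-6) by auto
    \<comment> \<open>Now \<open>b\<close> and \<open>c\<close> are 0 and 1 in some order, and
      \<open>d\<close> differs from both. So neither \<open>x\<close> nor \<open>y\<close> can equal
      \<open>d\<close>, which leaves only \<open>e\<close> for \<open>x\<close> and \<open>g\<close>
      for \<open>y\<close>.\<close>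
    then have "b \<noteq> c" "2 \<le> d"
      using b c \<open>b = g\<close> neq(3,5,6) by auto
    then have "x = c" "y = b"
      using all[OF less(1)] all[OF less(2)] neq(10-13) far(8,12) \<open>b = g\<close> \<open>c = e\<close> by auto
    then show ?thesis
      using b c \<open>b \<noteq> c\<close> by auto
  qed
qed

section \<open>Combining the two gadgets of \<open>G1\<close>\<close>

lemma no_packing_edge_coloring_G1: "\<not> packing_edge_coloring [1, 1, 2, 2] G1 C"
proof
  assume "packing_edge_coloring [1, 1, 2, 2] G1 C"
  then obtain c where "\<And>e. e \<in> edges G1 \<Longrightarrow> c e < length [1, 1, 2, 2 :: nat]"
    and dist: "\<And>e f. e \<in> edges G1 \<Longrightarrow> f \<in> edges G1 \<Longrightarrow> e \<noteq> f \<Longrightarrow> c e = c f \<Longrightarrow>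
      enat ([1, 1, 2, 2] ! c e + 1) \<le> edge_dist G1 e f"
    by (rule packing_edge_coloringE) (rule that)
  then have lt: "c e < 4" if "e \<in> edges G1" for e
    using that by force
  have colour_cases: "k = 0 \<or> k = 1 \<or> k = 2 \<or> k = 3" if "k < 4" for k :: nat
    using that by auto
  have neq: "c e \<noteq> c f" if "e \<in> edges G1" "f \<in> edges G1" "e \<noteq> f" "e \<inter> f \<noteq> {}" for e f
  proof
    assume "c e = c f"
    then have "enat ([1, 1, 2, 2] ! c e + 1) \<le> 1"
      using dist edge_dist_le_1 that by (meson order_trans)
    then show False
      using colour_cases[OF lt[OF that(1)]] by (auto simp: one_enat_def)
  qed
  \<comment> \<open>Equal colours 2 or 3 would require distance at least 3, but \<open>g\<close>
    gives at most 2. If \<open>g\<close> were \<open>e\<close> or \<open>f\<close>, these would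
    meet, contradicting \<open>neq\<close>.\<close>
  have far: "c e < 2" if asm: "e \<in> edges G1" "f \<in> edges G1" "e \<noteq> f"
    "\<exists>g\<in>edges G1. e \<inter> g \<noteq> {} \<and> g \<inter> f \<noteq> {}" "c e = c f" for e f
  proof -
    obtain g where "g \<in> edges G1" "e \<inter> g \<noteq> {}" "g \<inter> f \<noteq> {}"
      using asm(4) by blast
    then have "edge_dist G1 e f \<le> 2"
      using asm(1,2,3,5) neq[of e f] by (intro edge_dist_le_2[of e G1 f g]) auto
    then have "enat ([1, 1, 2, 2] ! c e + 1) \<le> 2"
      using dist asm by (meson order_trans)
    then show ?thesis
      using colour_cases[OF lt[OF asm(1)]] by (auto simp: numeral_eq_enat)
  qed
  have "c {1, 2} \<noteq> c {3, 4} \<and> (c {1, 2} < 2 \<longleftrightarrow> c {3, 4} < 2)"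
    by (rule gadget_end_colours[of _ _ "c {2, 3}" "c {2, 6}" "c {3, 7}" "c {6, 7}" "c {6, 8}" "c {7, 8}"];
      (rule lt neq | erule far[rotated 4]); simp add: G1_def doubleton_eq_iff)
  \<comment> \<open>The reflection of \<open>G1\<close> fixing \<open>u1\<close> swaps 2 with 5, 3
    with 4, 6 with 9, 7 with 10 and 8 with 11; it carries the first gadget to the second and keeps
    the edge \<open>{3, 4}\<close>.\<close>
  moreover have "c {5, 1} \<noteq> c {3, 4} \<and> (c {5, 1} < 2 \<longleftrightarrow> c {3, 4} < 2)"
    by (rule gadget_end_colours[of _ _ "c {4, 5}" "c {5, 9}" "c {4, 10}" "c {9, 10}" "c {9, 11}" "c {10, 11}"];
      (rule lt neq | erule far[rotated 4]); simp add: G1_def doubleton_eq_iff)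
  moreover have "c {1, 2} \<noteq> c {5, 1}"
    by (rule neq) (simp_all add: G1_def doubleton_eq_iff)
  moreover have "c {1, 2} < 4" "c {3, 4} < 4" "c {5, 1} < 4"
    by (rule lt; simp add: G1_def)+
  ultimately show False
    by linarith
qed

theorem mainTheorem9:
  "subcubic G1 \<and> outerplanar G1 \<and> k_connected 2 G1 \<and>
   \<not> (\<exists>C. packing_edge_coloring [1, 1, 2, 2] G1 C)"
  using subcubic_G1 outerplanar_G1 two_connected_G1 no_packing_edge_coloring_G1 by blast

end
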